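(* Let $q,m \in \mathbb{N}_0$. Then the following identities hold (the sums being taken in $\mathbb{Q}$): $$\binom{2m}{2q} = \binom mq \, \sum_{j=0}^q \frac{2^j}{j!\,(2j-1)!!} \, (q)_j (m-q)_j,$$ $$\binom{2m}{2q+1} = 2(m-q) \binom{m}{q} \, \sum_{j=0}^q \frac{2^j}{j!\,(2j+1)!!} \, (q)_j (m-q-1)_j,$$ $$\binom{2m+1}{2q} = (2q+1) \binom mq \, \sum_{j=0}^q \frac{2^j}{j!\,(2j+1)!!} \, (q)_j (m-q)_j,$$ $$\binom{2m+1}{2q+1} = (2(m-q)+1) \binom{m}{q} \, \sum_{j=0}^q \frac{2^j}{j!\,(2j+1)!!} \, (q)_j (m-q)_j.$$
   Context: $\mathbb{N}_0=\{0,1,2,\dots\}$. The double factorial is $n!!=n(n-2)(n-4)\cdots$ (ending in $1$ for $n$ odd), with $(-1)!!=1$. The falling factorial is $(n)_j=\prod_{k=0}^{j-1}(n-k)=n(n-1)\cdots(n-j+1)$, with $(n)_0=1$, for any integer $n$ (possibly negative). As usual $\binom{n}{k}=0$ for integers $k>n\ge 0$. *)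

theory Defs
  imports Complex_Main
begin

text \<open>
  The argument is an integer so that \<open>(2j - 1)!!\<close> can be written literally at \<open>j = 0\<close>:
  the values at \<open>0\<close> and \<open>-1\<close> are the empty product. The value \<open>1\<close> at arguments below \<open>-1\<close>
  is a convention without mathematical meaning.
\<close>

function double_fact :: "int \<Rightarrow> int" where
  "double_fact n = (if n \<le> 0 then 1 else n * double_fact (n - 2))"
  by auto
termination by (relation "measure nat") auto

declare double_fact.simps [simp del]

definition falling_fact :: "int \<Rightarrow> nat \<Rightarrow> int" where
  "falling_fact n j = (\<Prod>k<j. n - int k)"

end

(* Since (2j-1)!! = 2^j (1/2)_j and (2j+1)!! = 2^j (3/2)_j with rising factorials (c)_j, each sum
   is a terminating hypergeometric series F(-q, -p; c; 1) with c = 1/2 or 3/2 and p = m - q (or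
   m - q - 1), which Chu-Vandermonde evaluates to (c + p)_q / (c)_q. For c = 1/2 the first identity
   then follows from (2n)! = 4^n n! (1/2)_n; the other three reduce to it by absorption. *)
theory Submission
  imports Defs "HOL-Computational_Algebra.Formal_Power_Series"
begin

text \<open>Pulling one sign out of each factor turns falling into rising factorials, the form in
  which Chu-Vandermonde is available.\<close>

lemma of_int_falling_fact:
  "(of_int (falling_fact n j) :: rat) = (- 1) ^ j * pochhammer (- of_int n) j"
proof (induction j)
  case 0
  show ?case by (simp add: falling_fact_def)
next
  case (Suc j)
  then show ?case
    by (simp add: falling_fact_def pochhammer_Suc algebra_simps)
qed

lemma double_fact_odd_plus:
  "(of_int (double_fact (2 * int j + 1)) :: rat) = 2 ^ j * pochhammer (3/2) j"
proof (induction j)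
  case 0
  have "double_fact 1 = 1"
    using double_fact.simps[of 1] double_fact.simps[of "- 1"] by simp
  then show ?case by simp
next
  case (Suc j)
  \<comment> \<open>The new factor is 2j + 3 = 2 (3/2 + j), one 2 and one factor of the rising
    factorial.\<close>
  have "double_fact (2 * int (Suc j) + 1) = (2 * int j + 3) * double_fact (2 * int j + 1)"
    using double_fact.simps[of "2 * int (Suc j) + 1"] by (simp add: algebra_simps)
  with Suc show ?case
    by (simp add: pochhammer_Suc field_simps)
qed

text \<open>Both sides are \<open>pochhammer x (Suc n)\<close>, split off at its first or at its
  last factor. This converts base 3/2 to base 1/2 below.\<close>

lemma pochhammer_shift:
  fixes x :: rat
  shows "x * pochhammer (x + 1) n = (x + of_nat n) * pochhammer x n"
  using pochhammer_rec[of x n] pochhammer_Suc[of x n] by (simp add: mult.commute)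

lemma double_fact_odd_minus:
  "(of_int (double_fact (2 * int j - 1)) :: rat) = 2 ^ j * pochhammer (1/2) j"
proof (cases j)
  case 0
  then show ?thesis using double_fact.simps[of "- 1"] by simp
next
  \<comment> \<open>Here 2j - 1 = 2i + 1, and \<open>pochhammer (1/2) (Suc i)\<close> is 1/2 times
    \<open>pochhammer (3/2) i\<close>; the extra 2 in the power cancels the 1/2.\<close>
  case (Suc i)
  then show ?thesis
    using double_fact_odd_plus[of i] pochhammer_rec[of "1/2 :: rat" i] by (simp add: ac_simps)
qed

lemma pochhammer_pos_neq_0:
  fixes x :: rat
  shows "x > 0 \<Longrightarrow> pochhammer x n \<noteq> 0"
  using pochhammer_pos[of x n] by simp

text \<open>The powers of 2 cancel against \<open>D j\<close> and the signs of the two falling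
  factorials against each other, which leaves the Chu-Vandermonde sum. Since \<open>p\<close> is an
  integer, the value -1 is covered; it occurs in the second identity when m = q.\<close>

lemma sum_falling_fact:
  fixes c :: rat and D :: "nat \<Rightarrow> int" and p :: int
  assumes "c > 0" and D: "\<And>j. of_int (D j) = 2 ^ j * pochhammer c j"
  shows "(\<Sum>j\<le>q. 2 ^ j / (fact j * of_int (D j))
            * of_int (falling_fact (int q) j) * of_int (falling_fact p j))
         = pochhammer (c + of_int p) q / pochhammer c q"
proof -
  have "\<forall>i\<in>{0..<q}. c \<noteq> - of_nat i"
    using \<open>c > 0\<close> by auto
  from Vandermonde_pochhammer[OF this, of "- of_int p"]
  show ?thesis
    by (simp add: D of_int_falling_fact atLeast0AtMost power_mult_distrib[symmetric]
        ac_simps)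
qed

text \<open>Expand both binomials into factorials and apply the doubling formula to p + q, p and q:
  the powers of 4 cancel, and splitting \<open>pochhammer (1/2) (p + q)\<close> after its first p
  factors cancels \<open>pochhammer (1/2) p\<close>.\<close>

lemma even_binomial_pochhammer:
  "(of_nat ((2 * (p + q)) choose (2 * q)) :: rat) =
     of_nat ((p + q) choose q) * (pochhammer (1/2 + of_nat p) q / pochhammer (1/2) q)"
proof -
  have "pochhammer (1/2 :: rat) (p + q) = pochhammer (1/2) p * pochhammer (1/2 + of_nat p) q"
    by (rule pochhammer_product')
  moreover have "(2 :: rat) ^ (2 * (p + q)) = 2 ^ (2 * p) * 2 ^ (2 * q)"
    by (simp add: power_add distrib_left)
  moreover have "of_nat ((2 * (p + q)) choose (2 * q))
      = (fact (2 * (p + q)) / (fact (2 * q) * fact (2 * p)) :: rat)"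
    using binomial_fact[of "2 * q" "2 * (p + q)"] by (simp add: distrib_left)
  moreover have "of_nat ((p + q) choose q) = (fact (p + q) / (fact q * fact p) :: rat)"
    using binomial_fact[of q "p + q"] by simp
  moreover have "pochhammer (1/2 :: rat) p \<noteq> 0"
    by (rule pochhammer_pos_neq_0) simp
  ultimately show ?thesis
    by (simp only: fact_double) (simp add: ac_simps)
qed

text \<open>With n = p + q, the two absorption rules turn both sides into 2n times the entry 2q of
  row 2n - 1.\<close>

lemma binomial_step_right:
  "(2 * of_nat q + 1) * (of_nat ((2 * (p + q)) choose (2 * q + 1)) :: rat)
     = 2 * of_nat p * of_nat ((2 * (p + q)) choose (2 * q))"
proof -
  have "(2 * q + 1) * ((2 * (p + q)) choose (2 * q + 1)) = 2 * p * ((2 * (p + q)) choose (2 * q))"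
    using binomial_absorption[of "2 * q" "2 * (p + q)"]
      binomial_absorb_comp[of "2 * (p + q)" "2 * q"] by simp
  from arg_cong[OF this, of "of_nat :: nat \<Rightarrow> rat"] show ?thesis
    by (simp only: of_nat_mult of_nat_add of_nat_numeral of_nat_1)
qed

lemma binomial_step_up:
  "(2 * of_nat p + 1) * (of_nat ((2 * (p + q) + 1) choose (2 * q)) :: rat)
     = (2 * of_nat (p + q) + 1) * of_nat ((2 * (p + q)) choose (2 * q))"
proof -
  have "(2 * p + 1) * ((2 * (p + q) + 1) choose (2 * q))
      = (2 * (p + q) + 1) * ((2 * (p + q)) choose (2 * q))"
    using binomial_absorb_comp[of "2 * (p + q) + 1" "2 * q"] by simp
  from arg_cong[OF this, of "of_nat :: nat \<Rightarrow> rat"] show ?thesis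
    by (simp only: of_nat_mult of_nat_add of_nat_numeral of_nat_1)
qed

lemma binomial_step_diagonal:
  "(2 * of_nat q + 1) * (of_nat ((2 * n + 1) choose (2 * q + 1)) :: rat)
     = (2 * of_nat n + 1) * of_nat ((2 * n) choose (2 * q))"
proof -
  have "(2 * q + 1) * ((2 * n + 1) choose (2 * q + 1)) = (2 * n + 1) * ((2 * n) choose (2 * q))"
    using Suc_times_binomial[of "2 * q" "2 * n"] by simp
  from arg_cong[OF this, of "of_nat :: nat \<Rightarrow> rat"] show ?thesis
    by (simp only: of_nat_mult of_nat_add of_nat_numeral of_nat_1)
qed

theorem theorem4p3:
  fixes q m :: nat
  shows "(of_nat ((2 * m) choose (2 * q)) :: rat) =
           of_nat (m choose q) *
             (\<Sum>j\<le>q. 2 ^ j / (fact j * of_int (double_fact (2 * int j - 1)))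
                * of_int (falling_fact (int q) j)
                * of_int (falling_fact (int m - int q) j))
        \<and> (of_nat ((2 * m) choose (2 * q + 1)) :: rat) =
           2 * (of_nat m - of_nat q) * of_nat (m choose q) *
             (\<Sum>j\<le>q. 2 ^ j / (fact j * of_int (double_fact (2 * int j + 1)))
                * of_int (falling_fact (int q) j)
                * of_int (falling_fact (int m - int q - 1) j))
        \<and> (of_nat ((2 * m + 1) choose (2 * q)) :: rat) =
           (2 * of_nat q + 1) * of_nat (m choose q) *
             (\<Sum>j\<le>q. 2 ^ j / (fact j * of_int (double_fact (2 * int j + 1)))
                * of_int (falling_fact (int q) j)
                * of_int (falling_fact (int m - int q) j))
        \<and> (of_nat ((2 * m + 1) choose (2 * q + 1)) :: rat) =
           (2 * (of_nat m - of_nat q) + 1) * of_nat (m choose q) *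
             (\<Sum>j\<le>q. 2 ^ j / (fact j * of_int (double_fact (2 * int j + 1)))
                * of_int (falling_fact (int q) j)
                * of_int (falling_fact (int m - int q) j))"
proof (cases "q \<le> m")
  case False
  then show ?thesis by (simp add: binomial_eq_0)
next
  case True
  then obtain p where m: "m = p + q"
    by (metis add.commute le_Suc_ex)
  define B :: rat where "B = of_nat (m choose q)"
  define C :: rat where "C = of_nat ((2 * m) choose (2 * q))"
  define P :: rat where "P = pochhammer (1/2 + of_nat p) q"
  define Q :: rat where "Q = pochhammer (1/2) q"
  have "Q \<noteq> 0"
    unfolding Q_def by (rule pochhammer_pos_neq_0) simp
  have C: "C = B * (P / Q)"
    unfolding B_def C_def P_def Q_def m by (rule even_binomial_pochhammer)
  \<comment> \<open>The shift from base 1/2 + p contributes the ratio (1/2 + p + q) / (1/2 + p), and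
    p + q = m.\<close>
  have num: "pochhammer (3/2 + of_nat p) q = (2 * of_nat m + 1) / (2 * of_nat p + 1) * P"
    using pochhammer_shift[of "1/2 + of_nat p" q]
    by (simp add: P_def m field_simps add_pos_nonneg)
  have den: "pochhammer (3/2) q = (2 * of_nat q + 1) * Q"
    using pochhammer_shift[of "1/2" q] by (simp add: Q_def field_simps)
  have sub: "int m - int q = int p" by (simp add: m)
  have sum1: "(\<Sum>j\<le>q. 2 ^ j / (fact j * of_int (double_fact (2 * int j - 1)))
        * of_int (falling_fact (int q) j) * of_int (falling_fact (int m - int q) j)) = P / Q"
    using sum_falling_fact[OF _ double_fact_odd_minus, of q "int p"] by (simp add: sub P_def Q_def)
  \<comment> \<open>Since 3/2 + (p - 1) = 1/2 + p, the numerator is \<open>P\<close> again and only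
    the denominator changes.\<close>
  have sum2: "(\<Sum>j\<le>q. 2 ^ j / (fact j * of_int (double_fact (2 * int j + 1)))
        * of_int (falling_fact (int q) j) * of_int (falling_fact (int m - int q - 1) j))
      = P / ((2 * of_nat q + 1) * Q)"
    using sum_falling_fact[OF _ double_fact_odd_plus, of q "int p - 1"]
    by (simp add: sub P_def den)
  have sum3: "(\<Sum>j\<le>q. 2 ^ j / (fact j * of_int (double_fact (2 * int j + 1)))
        * of_int (falling_fact (int q) j) * of_int (falling_fact (int m - int q) j))
      = (2 * of_nat m + 1) / (2 * of_nat p + 1) * P / ((2 * of_nat q + 1) * Q)"
    using sum_falling_fact[OF _ double_fact_odd_plus, of q "int p"]
    by (simp add: sub num den)
  have pq: "2 * (of_nat p :: rat) + 1 \<noteq> 0" "2 * (of_nat q :: rat) + 1 \<noteq> 0"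
    using of_nat_0_le_iff[where 'a = rat, of p] of_nat_0_le_iff[where 'a = rat, of q] by linarith+
  have mq: "of_nat m - of_nat q = (of_nat p :: rat)" by (simp add: m)
  have step1: "of_nat ((2 * m) choose (2 * q + 1)) = 2 * of_nat p * C / (2 * of_nat q + 1)"
    using binomial_step_right[of q p] pq unfolding C_def m
    by (simp only: eq_divide_eq if_False if_True not_False_eq_True mult.commute)
  have step2: "of_nat ((2 * m + 1) choose (2 * q)) = (2 * of_nat m + 1) * C / (2 * of_nat p + 1)"
    using binomial_step_up[of p q] pq unfolding C_def m
    by (simp only: eq_divide_eq if_False if_True not_False_eq_True mult.commute)
  have step3: "of_nat ((2 * m + 1) choose (2 * q + 1)) = (2 * of_nat m + 1) * C / (2 * of_nat q + 1)"
    using binomial_step_diagonal[of q m] pq unfolding C_def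
    by (simp only: eq_divide_eq if_False if_True not_False_eq_True mult.commute)
  \<comment> \<open>Everything is now a rational multiple of \<open>B * (P / Q)\<close>; cancelling
    2p + 1, 2q + 1 and \<open>Q\<close> settles all four identities.\<close>
  show ?thesis
    unfolding sum1 sum2 sum3 step1 step2 step3 mq C_def[symmetric] B_def[symmetric]
    unfolding C using pq \<open>Q \<noteq> 0\<close> by (simp add: ac_simps)
qed

end
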